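(* Hyperbolic uniform disk graphs with constant clique number do not admit product structure. That is, there is a constant $\omega_0$ such that for every constant $c$ there is a hyperbolic uniform disk graph $G$ with clique number at most $\omega_0$ that is not a subgraph of $H \boxtimes P$ for any graph $H$ of treewidth at most $c$ and any path $P$.
   Context: Graphs are finite and simple. For $r>0$, a graph $G$ is a hyperbolic uniform disk graph (HUDG) with disk radius $r$ if it is the intersection graph of (closed) disks of radius $r$ in the hyperbolic plane (of curvature $-1$); equivalently, vertices are assigned to points of the hyperbolic plane and two distinct vertices are adjacent if and only if their points have hyperbolic distance at most $2r$. $G$ is a HUDG if it is a HUDG with disk radius $r$ for some $r>0$ (which may depend on $G$). The clique number is the number of vertices of a largest complete subgraph. The strong product $G\boxtimes H$ has vertex set $V(G)\times V(H)$, and two distinct vertices $(u_G,u_H)$, $(v_G,v_H)$ are adjacent if and only if ($u_G=v_G$ or $u_Gv_G\in E(G)$) and ($u_H=v_H$ or $u_Hv_H\in E(H)$). "$G$ is a subgraph of $H$" means that $G$ is isomorphic to a subgraph of $H$. The row-treewidth of $G$ is the smallest $t$ such that $G\subseteq H\boxtimes P$ for some graph $H$ of treewidth $t$ and some path $P$. A graph class admits product structure if the row-treewidth of its members is bounded by a constant. *)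

theory Defs
  imports Complex_Main "Graph_Theory.Graph_Theory"
begin

text \<open>
  A finite simple graph is a \<^locale>\<open>pair_graph\<close>: a finite, loop-free, symmetric digraph without
  parallel arcs, so that an edge uv is the pair of arcs (u,v), (v,u).
\<close>

subsection \<open>Subgraphs and cliques\<close>

definition embeds_as_subgraph :: "'a pair_pre_digraph \<Rightarrow> 'b pair_pre_digraph \<Rightarrow> bool" where
  "embeds_as_subgraph G H \<longleftrightarrow>
     (\<exists>S. subgraph (with_proj S) (with_proj H) \<and> digraph_iso (with_proj G) (with_proj S))"

definition clique_number :: "'a pair_pre_digraph \<Rightarrow> nat" where
  "clique_number G =
     Max {n. \<exists>K :: 'a pair_pre_digraph. subgraph (with_proj K) (with_proj G) \<and>
                complete_digraph n (with_proj K)}"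

subsection \<open>Paths and strong products\<close>

definition path_graph :: "'a pair_pre_digraph \<Rightarrow> bool" where
  "path_graph P \<longleftrightarrow>
     (\<exists>vs. vs \<noteq> [] \<and> distinct vs \<and> pverts P = set vs \<and>
           parcs P = set (vwalk_arcs vs) \<union> (set (vwalk_arcs vs))\<inverse>)"

definition strong_product ::
    "'a pair_pre_digraph \<Rightarrow> 'b pair_pre_digraph \<Rightarrow> ('a \<times> 'b) pair_pre_digraph"
    (infixl \<open>\<boxtimes>\<close> 70) where
  "G \<boxtimes> H =
     \<lparr> pverts = pverts G \<times> pverts H,
       parcs = {(x, y). x \<in> pverts G \<times> pverts H \<and> y \<in> pverts G \<times> pverts H \<and> x \<noteq> y \<and>
                  (fst x = fst y \<or> (fst x, fst y) \<in> parcs G) \<and>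
                  (snd x = snd y \<or> (snd x, snd y) \<in> parcs H)} \<rparr>"

subsection \<open>Treewidth\<close>

text \<open>
  The library's \<^const>\<open>tree\<close> forbids all directed cycles, including the closed walk along (u,v), (v,u),
  and therefore does not describe trees among symmetric digraphs. Undirected cycles are the
  directed cycles of length at least 3.
\<close>

definition tree_graph :: "'a pair_pre_digraph \<Rightarrow> bool" where
  "tree_graph T \<longleftrightarrow>
     pair_graph T \<and> Digraph_Component.connected (with_proj T) \<and>
     \<not> (\<exists>p. pre_digraph.cycle (with_proj T) p \<and> length p \<ge> 3)"

text \<open>\<^const>\<open>Digraph_Component.connected\<close> includes nonemptiness of the vertex set.\<close>

definition tree_decomposition ::
    "'a pair_pre_digraph \<Rightarrow> 't pair_pre_digraph \<Rightarrow> ('t \<Rightarrow> 'a set) \<Rightarrow> bool" where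
  "tree_decomposition G T B \<longleftrightarrow>
     tree_graph T \<and>
     (\<Union>t \<in> pverts T. B t) = pverts G \<and>
     (\<forall>(u, v) \<in> parcs G. \<exists>t \<in> pverts T. u \<in> B t \<and> v \<in> B t) \<and>
     (\<forall>v \<in> pverts G.
        Digraph_Component.connected (with_proj T \<restriction> {t \<in> pverts T. v \<in> B t}))"

text \<open>
  Natural-number subtraction only matters for the graph without vertices, which gets treewidth 0.
\<close>

definition decomposition_width :: "'t pair_pre_digraph \<Rightarrow> ('t \<Rightarrow> 'a set) \<Rightarrow> nat" where
  "decomposition_width T B = Max ((\<lambda>t. card (B t)) ` pverts T) - 1"

text \<open>Decomposition trees are finite, so taking their nodes in \<^typ>\<open>nat\<close> loses no generality.\<close>

definition treewidth :: "'a pair_pre_digraph \<Rightarrow> nat" where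
  "treewidth G =
     (LEAST k. \<exists>(T :: nat pair_pre_digraph) B.
                 tree_decomposition G T B \<and> decomposition_width T B = k)"

subsection \<open>Hyperbolic uniform disk graphs\<close>

text \<open>The upper half-plane model of the hyperbolic plane of curvature -1.\<close>

definition hyperbolic_plane :: "complex set" where
  "hyperbolic_plane = {z. Im z > 0}"

definition hyperbolic_dist :: "complex \<Rightarrow> complex \<Rightarrow> real" where
  "hyperbolic_dist z w = arcosh (1 + (cmod (z - w))\<^sup>2 / (2 * Im z * Im w))"

text \<open>The centres of the disks need not be distinct.\<close>

definition hudg_with_radius :: "real \<Rightarrow> 'a pair_pre_digraph \<Rightarrow> bool" where
  "hudg_with_radius r G \<longleftrightarrow>
     pair_graph G \<and>
     (\<exists>c. (\<forall>v \<in> pverts G. c v \<in> hyperbolic_plane) \<and>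
          (\<forall>u \<in> pverts G. \<forall>v \<in> pverts G. u \<noteq> v \<longrightarrow>
             ((u, v) \<in> parcs G \<longleftrightarrow> hyperbolic_dist (c u) (c v) \<le> 2 * r)))"

definition hudg :: "'a pair_pre_digraph \<Rightarrow> bool" where
  "hudg G \<longleftrightarrow> (\<exists>r > 0. hudg_with_radius r G)"

end

theory Submission
  imports Defs
begin

text \<open>
  The graphs consist of a complete minor whose branch sets are all dominated by one additional vertex,
  the apex. Such a graph is not contained in \<open>H \<boxtimes> P\<close> for \<open>H\<close> of small treewidth: all of it would lie
  in at most three consecutive layers of the product, which have room for only
  \<open>3 * (treewidth H + 1)\<close> branch sets (\<open>dominated_clique_minor_in_product\<close>). The bound comes from the Helly property of subtrees
  (\<open>subtrees_helly\<close>): pairwise touching branch sets share a bag.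

  What remains is to realise such graphs by hyperbolic disks of equal radius without creating large
  cliques. For very large radius, centres can be chosen in the upper half-plane such that, after
  a horizontal rescaling, two of them are adjacent roughly iff their horizontal distance is at most
  the geometric mean of their heights. Hence points of height and spacing \<open>1 / N\<close> form a path, called
  a row. A row of points at smaller height and with correspondingly smaller spacing is
  adjacent to each row above it, since every point of the upper row has a point of the lower row
  almost exactly below it. So any \<open>m\<close> rows that span the same interval are the branch sets of a complete
  minor (\<open>rows_touch\<close>), and a point placed sufficiently high is adjacent to all of them (\<open>apex_arc\<close>).

  The clique number stays bounded because the heights decrease very fast and the rows are staggered.
  Points of a low row only see points of higher rows that are nearly above them, and no two points
  of different higher rows are close enough to be seen from the same place
  (\<open>no_common_neighbour_in_lower_row\<close>). A clique therefore meets at most two rows, each in at most two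
  consecutive points, and has at most five vertices together with the apex.
\<close>

section \<open>Connected vertex sets\<close>

text \<open>
  Connectedness of the subgraph induced on \<open>S\<close>, for symmetric \<open>E\<close>. A bare relation instead of a digraph lets the same notion
  serve for the rows of the disk graph and for the subtrees of the decomposition tree.
\<close>

definition connected_in :: "'a rel \<Rightarrow> 'a set \<Rightarrow> bool" where
  "connected_in E S \<longleftrightarrow> S \<noteq> {} \<and> (\<forall>u\<in>S. \<forall>v\<in>S. (u, v) \<in> rtrancl_on S E)"

lemma connected_inD: "connected_in E S \<Longrightarrow> u \<in> S \<Longrightarrow> v \<in> S \<Longrightarrow> (u, v) \<in> rtrancl_on S E"
  by (simp add: connected_in_def)

text \<open>
  A walk in \<open>R\<close> lifts to a walk in the union: each step from \<open>u\<close> to \<open>v\<close> is made inside \<open>F u\<close> up to a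
  common element of \<open>F u\<close> and \<open>F v\<close>. With the nodes of a tree
  decomposition whose bags contain a given vertex, this makes connected sets of vertices trace
  out subtrees.
\<close>

lemma connected_in_UN:
  assumes R: "connected_in E R"
    and F: "\<And>v. v \<in> R \<Longrightarrow> connected_in E' (F v)"
    and touch: "\<And>u v. u \<in> R \<Longrightarrow> v \<in> R \<Longrightarrow> (u, v) \<in> E \<Longrightarrow> F u \<inter> F v \<noteq> {}"
  shows "connected_in E' (\<Union>v\<in>R. F v)"
proof -
  let ?U = "\<Union>v\<in>R. F v"
  have inner: "(s, t) \<in> rtrancl_on ?U E'" if "v \<in> R" "s \<in> F v" "t \<in> F v" for v s t
    using connected_inD[OF F[OF that(1)] that(2,3)]
    using that(1) by (intro rtrancl_on_mono[of E' E' "F v" ?U]) auto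
  have reach: "(s, t) \<in> rtrancl_on ?U E'" if "(u, v) \<in> rtrancl_on R E" "s \<in> F u" "t \<in> F v" for u v s t
    using that(1,3)
  proof (induction arbitrary: t rule: rtrancl_on_induct)
    case base
    then show ?case using inner that(2) by blast
  next
    case (step v w)
    obtain x where x: "x \<in> F v" "x \<in> F w"
      using touch[OF step.hyps(3,4,2)] by blast
    show ?case
      using rtrancl_on_trans[OF step.IH[OF x(1)] inner[OF step.hyps(4) x(2) step.prems]] .
  qed
  obtain v where v: "v \<in> R" using R by (auto simp: connected_in_def)
  have "F v \<noteq> {}" using F[OF v] by (simp add: connected_in_def)
  then have "?U \<noteq> {}" using v by blast
  moreover have "(s, t) \<in> rtrancl_on ?U E'" if st: "s \<in> ?U" "t \<in> ?U" for s t
  proof -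
    obtain u v where "u \<in> R" "s \<in> F u" "v \<in> R" "t \<in> F v" using st by blast
    then show ?thesis using reach connected_inD[OF R] by metis
  qed
  ultimately show ?thesis
    by (simp only: connected_in_def) blast
qed

lemma connected_in_consecutive:
  assumes E: "sym E" and n: "0 < n"
    and step: "\<And>i. Suc i < n \<Longrightarrow> (f i, f (Suc i)) \<in> E"
  shows "connected_in E (f ` {..<n})"
proof -
  let ?S = "f ` {..<n}"
  have up: "(f 0, f i) \<in> rtrancl_on ?S E" if "i < n" for i
    using that
  proof (induction i)
    case (Suc i)
    then show ?case
      using step[of i] by (auto intro: rtrancl_on_into_rtrancl_on[of "f 0" "f i"])
  qed auto
  have down: "(f i, f 0) \<in> rtrancl_on ?S E" if "i < n" for i
    using rtrancl_on_converseI[OF up[OF that]] E by (simp add: sym_conv_converse_eq)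
  have "(f i, f j) \<in> rtrancl_on ?S E" if "i < n" "j < n" for i j
    using rtrancl_on_trans[OF down[OF that(1)] up[OF that(2)]] .
  then show ?thesis
    using n by (auto simp: connected_in_def)
qed

text \<open>
  A walk that enters a vertex with only one neighbour must leave it to where it came from, so the
  detour can be cut out. The induction keeps track of that neighbour while the walk is at the leaf.
\<close>

lemma connected_in_remove_leaf:
  assumes S: "connected_in E S" and E: "sym E"
    and leaf: "\<And>a b. a \<in> S \<Longrightarrow> b \<in> S \<Longrightarrow> (l, a) \<in> E \<Longrightarrow> (l, b) \<in> E \<Longrightarrow> a = b"
    and ne: "S \<noteq> {l}"
  shows "connected_in E (S - {l})"
proof -
  let ?S = "S - {l}"
  have key: "(v \<noteq> l \<longrightarrow> (u, v) \<in> rtrancl_on ?S E) \<and>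
        (v = l \<longrightarrow> (\<exists>w. (l, w) \<in> E \<and> w \<in> ?S \<and> (u, w) \<in> rtrancl_on ?S E))"
    if "(u, v) \<in> rtrancl_on S E" "u \<noteq> l" for u v
    using that(1)
  proof (induction rule: rtrancl_on_induct)
    case base
    then show ?case using that(2) by auto
  next
    case (step v w)
    show ?case
    proof (cases "v = l")
      case True
      then obtain x where x: "(l, x) \<in> E" "x \<in> ?S" "(u, x) \<in> rtrancl_on ?S E"
        using step.IH by blast
      have "w = x" using leaf[of w x] x step True by auto
      then show ?thesis using x by auto
    next
      case False
      then show ?thesis
        using step E by (auto intro: rtrancl_on_into_rtrancl_on dest: symD)
    qed
  qed
  have "(u, v) \<in> rtrancl_on ?S E" if "u \<in> ?S" "v \<in> ?S" for u v
    using key[of u v] connected_inD[OF S, of u v] that by simp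
  moreover have "?S \<noteq> {}" using S ne by (auto simp: connected_in_def)
  ultimately show ?thesis by (simp add: connected_in_def)
qed

section \<open>Subtrees of a tree have the Helly property\<close>

text \<open>
  The acyclicity half of \<^const>\<open>tree_graph\<close>. It guarantees a leaf in every nonempty finite set of
  nodes, also in the possibly disconnected ones that are left when leaves are pruned.
\<close>

definition no_long_cycle :: "'a pair_pre_digraph \<Rightarrow> bool" where
  "no_long_cycle T \<longleftrightarrow> \<not> (\<exists>p. pre_digraph.cycle (with_proj T) p \<and> length p \<ge> 3)"

lemma pcas_vwalk_arcs: "pcas u (vwalk_arcs (u # vs)) (last (u # vs))"
  by (induction vs arbitrary: u) auto

lemma pawalk_verts_vwalk_arcs: "pawalk_verts u (vwalk_arcs (u # vs)) = u # vs"
  by (induction vs arbitrary: u) auto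

lemma closed_vwalk_cycle:
  assumes "pair_graph T" and vs: "distinct (u # vs)" "vs \<noteq> []"
    and arcs: "set (vwalk_arcs (u # vs @ [u])) \<subseteq> parcs T"
  shows "pre_digraph.cycle (with_proj T) (vwalk_arcs (u # vs @ [u]))"
proof -
  interpret T: pair_graph T by fact
  have "(u, hd vs) \<in> parcs T"
    using arcs vs(2) by (cases vs) auto
  then have "u \<in> pverts T" by (rule T.in_arcsD1)
  moreover have "vwalk_arcs (u # vs @ [u]) \<noteq> []"
    by (cases vs) auto
  ultimately show ?thesis
    using arcs vs pcas_vwalk_arcs[of u "vs @ [u]"] pawalk_verts_vwalk_arcs[of u "vs @ [u]"]
    unfolding pre_digraph.cycle_def pre_digraph.awalk_def
    by (intro exI[of _ u]) (auto simp: cas_with_proj_eq awalk_verts_with_proj_eq)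
qed

text \<open>
  The first vertex of a longest path inside \<open>V\<close> is a leaf: by maximality all its neighbours lie
  on the path, and a neighbour beyond the second position would close a cycle.
\<close>

lemma forest_has_leaf:
  assumes T: "pair_graph T" and acyclic: "no_long_cycle T"
    and V: "finite V" "V \<noteq> {}"
  obtains l where "l \<in> V"
    "\<And>a b. a \<in> V \<Longrightarrow> b \<in> V \<Longrightarrow> (l, a) \<in> parcs T \<Longrightarrow> (l, b) \<in> parcs T \<Longrightarrow> a = b"
proof -
  interpret T: pair_graph T by fact
  define path where
    "path = (\<lambda>vs. vs \<noteq> [] \<and> distinct vs \<and> set vs \<subseteq> V \<and> set (vwalk_arcs vs) \<subseteq> parcs T)"
  obtain v where "v \<in> V" using V by blast
  then have "path [v]" by (simp add: path_def)
  moreover have "length vs < Suc (card V)" if "path vs" for vs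
    using that V(1) card_mono[of V "set vs"] by (auto simp: path_def distinct_card)
  ultimately obtain vs where vs: "path vs" and longest: "\<And>ws. path ws \<Longrightarrow> length ws \<le> length vs"
    using ex_has_greatest_nat[of path "[v]" length "Suc (card V)"] by (auto simp: less_imp_le)
  obtain l ws where lws: "vs = l # ws" using vs by (cases vs) (auto simp: path_def)
  have second: "ws \<noteq> [] \<and> a = hd ws" if a: "a \<in> V" "(l, a) \<in> parcs T" for a
  proof -
    have "(a, l) \<in> parcs T"
      using a(2) T.pair_sym_arcs by (auto simp: symmetric_def dest: symD)
    then have "path (a # vs)" if "a \<notin> set vs"
      using that vs a(1) lws by (auto simp: path_def)
    then have "a \<in> set vs" using longest[of "a # vs"] by auto
    moreover have "a \<noteq> l" using T.no_loops'[OF a(2)] by auto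
    ultimately obtain xs ys where ws: "ws = xs @ a # ys"
      using lws by (auto dest: split_list)
    have "xs = []"
    proof (rule ccontr)
      assume xs: "xs \<noteq> []"
      have "set (vwalk_arcs (l # xs @ [a])) \<subseteq> parcs T"
        using vs lws ws set_vwalk_arcs_append1[of "l # xs @ [a]" ys] by (auto simp: path_def)
      then have "set (vwalk_arcs (l # (xs @ [a]) @ [l])) \<subseteq> parcs T"
        using \<open>(a, l) \<in> parcs T\<close> vwalk_arcs_append[of "l # xs @ [a]" "[l]"] by auto
      moreover have "distinct (l # xs @ [a])"
        using vs lws ws by (auto simp: path_def)
      ultimately have "pre_digraph.cycle (with_proj T) (vwalk_arcs (l # (xs @ [a]) @ [l]))"
        by (intro closed_vwalk_cycle[OF T]) auto
      moreover have "length (vwalk_arcs (l # (xs @ [a]) @ [l])) \<ge> 3"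
        using vwalk_length_simp[of "l # (xs @ [a]) @ [l]"] xs
        unfolding vwalk_length_def by (cases xs) auto
      ultimately show False using acyclic unfolding no_long_cycle_def by blast
    qed
    then show ?thesis using ws by simp
  qed
  have "l \<in> V" using vs lws by (simp add: path_def)
  then show thesis using that second by metis
qed

text \<open>
  Prune a leaf \<open>l\<close>. If \<open>{l}\<close> is one of the sets, then \<open>l\<close> is common to all. Otherwise removing \<open>l\<close>
  keeps all sets connected and nonempty, and two sets that met only in \<open>l\<close> would both contain the
  unique neighbour of \<open>l\<close>, so the pruned sets still meet pairwise.
\<close>

lemma subtrees_helly:
  assumes T: "pair_graph T" and acyclic: "no_long_cycle T"
    and V: "finite V" and ne: "\<S> \<noteq> {}"
    and sub: "\<And>S. S \<in> \<S> \<Longrightarrow> S \<subseteq> V"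
    and conn: "\<And>S. S \<in> \<S> \<Longrightarrow> connected_in (parcs T) S"
    and meet: "\<And>S S'. S \<in> \<S> \<Longrightarrow> S' \<in> \<S> \<Longrightarrow> S \<inter> S' \<noteq> {}"
  shows "\<Inter>\<S> \<noteq> {}"
  using V ne sub conn meet
proof (induction "card V" arbitrary: V \<S> rule: less_induct)
  case less
  interpret T: pair_graph T by fact
  have sym: "sym (parcs T)" using T.pair_sym_arcs by (simp add: symmetric_def)
  have "V \<noteq> {}" using less.prems unfolding connected_in_def by fastforce
  then obtain l where l: "l \<in> V"
    and leaf: "\<And>a b. a \<in> V \<Longrightarrow> b \<in> V \<Longrightarrow> (l, a) \<in> parcs T \<Longrightarrow> (l, b) \<in> parcs T \<Longrightarrow> a = b"
    using forest_has_leaf[OF T acyclic less.prems(1)] by metis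
  show ?case
  proof (cases "{l} \<in> \<S>")
    case True
    then have "l \<in> S" if "S \<in> \<S>" for S using less.prems(5)[OF True that] by auto
    then show ?thesis by blast
  next
    case False
    have nbr: "\<exists>a\<in>S. (l, a) \<in> parcs T" if S: "S \<in> \<S>" "l \<in> S" for S
    proof -
      have "S \<noteq> {l}" using S(1) False by auto
      then obtain u where u: "u \<in> S" "u \<noteq> l" using S(2) by auto
      have "(l, u) \<in> rtrancl_on S (parcs T)"
        using connected_inD[OF less.prems(4)[OF S(1)] S(2) u(1)] .
      then show ?thesis
        using u(2) by (cases rule: converse_rtrancl_on_cases) (auto dest: in_rtrancl_on_in_F)
    qed
    let ?\<S> = "(\<lambda>S. S - {l}) ` \<S>"
    have "\<Inter>?\<S> \<noteq> {}"
    proof (rule less.hyps[of "V - {l}"])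
      show "card (V - {l}) < card V" using l less.prems(1) by (meson card_Diff1_less)
      show "finite (V - {l})" "?\<S> \<noteq> {}" using less.prems by auto
      show "S \<subseteq> V - {l}" if "S \<in> ?\<S>" for S using that less.prems(3) by auto
      show "connected_in (parcs T) S" if S: "S \<in> ?\<S>" for S
      proof -
        obtain S' where S': "S' \<in> \<S>" "S = S' - {l}" using S by blast
        have "connected_in (parcs T) (S' - {l})"
          using less.prems(3)[OF S'(1)] False S'(1)
          by (intro connected_in_remove_leaf[OF less.prems(4)[OF S'(1)] sym] leaf) auto
        then show ?thesis using S' by simp
      qed
      show "S \<inter> S' \<noteq> {}" if SS: "S \<in> ?\<S>" "S' \<in> ?\<S>" for S S'
      proof -
        obtain A B where A: "A \<in> \<S>" "S = A - {l}" and B: "B \<in> \<S>" "S' = B - {l}"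
          using SS by blast
        obtain t where t: "t \<in> A" "t \<in> B" using less.prems(5)[OF A(1) B(1)] by blast
        show ?thesis
        proof (cases "t = l")
          case True
          obtain a b where ab: "a \<in> A" "(l, a) \<in> parcs T" "b \<in> B" "(l, b) \<in> parcs T"
            using nbr[OF A(1)] nbr[OF B(1)] t True by blast
          then have "a = b" using leaf less.prems(3) A B by blast
          then show ?thesis using ab T.no_loops' A B by blast
        qed (use t A B in auto)
      qed
    qed
    then obtain t where "\<And>S. S \<in> \<S> \<Longrightarrow> t \<in> S" by blast
    then show ?thesis by blast
  qed
qed

section \<open>Dominated clique minors in strong products with a path\<close>

text \<open>
  The set \<open>N\<close> consists of the entry \<open>p\<close> of the path and the entries before and after it.
\<close>

lemma path_closed_neighbourhood:
  assumes "path_graph P"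
  obtains N where "finite N" "card N \<le> 3" "p \<in> N" "\<And>q. (p, q) \<in> parcs P \<Longrightarrow> q \<in> N"
proof -
  obtain vs where vs: "distinct vs" "parcs P = set (vwalk_arcs vs) \<union> (set (vwalk_arcs vs))\<inverse>"
    using assms unfolding path_graph_def by blast
  have idx: "\<exists>i. Suc i < length ws \<and> a = ws ! i \<and> b = ws ! Suc i"
    if "(a, b) \<in> set (vwalk_arcs ws)" for a b and ws :: "'a list"
    using that
  proof (induction ws rule: vwalk_arcs.induct)
    case (3 x y xs)
    show ?case
    proof (cases "(a, b) = (x, y)")
      case False
      then obtain i where "Suc i < length (y # xs)" "a = (y # xs) ! i" "b = (y # xs) ! Suc i"
        using 3 by auto
      then show ?thesis by (intro exI[of _ "Suc i"]) auto
    qed (auto intro!: exI[of _ 0])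
  qed auto
  have "\<exists>i. p \<in> set vs \<longrightarrow> i < length vs \<and> vs ! i = p"
    by (cases "p \<in> set vs") (auto simp: in_set_conv_nth)
  then obtain i where i: "p \<in> set vs \<Longrightarrow> i < length vs \<and> vs ! i = p" by blast
  \<comment> \<open>At the ends of the path, or for \<open>p\<close> outside of it, some entries are meaningless but harmless.\<close>
  let ?N = "{vs ! (i - 1), p, vs ! Suc i}"
  have "q \<in> ?N" if pq: "(p, q) \<in> parcs P" for q
  proof -
    have "(p, q) \<in> set (vwalk_arcs vs) \<or> (q, p) \<in> set (vwalk_arcs vs)"
      using pq vs(2) by auto
    then consider j where "Suc j < length vs" "p = vs ! j" "q = vs ! Suc j"
      | j where "Suc j < length vs" "q = vs ! j" "p = vs ! Suc j"
      by (elim disjE) (use idx in metis)+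
    then show ?thesis
    proof cases
      case 1
      then have "i < length vs" "vs ! i = vs ! j" using i by auto
      then have "j = i" using 1 vs(1) by (simp add: nth_eq_iff_index_eq)
      then show ?thesis using 1 by auto
    next
      case 2
      then have "i < length vs" "vs ! i = vs ! Suc j" using i by auto
      then have "i = Suc j" using 2 vs(1) by (simp add: nth_eq_iff_index_eq)
      then show ?thesis using 2 by auto
    qed
  qed
  moreover have "card ?N \<le> 3" by (simp add: card_insert_if)
  ultimately show thesis by (intro that[of ?N]) auto
qed

text \<open>
  The single-bag decomposition shows that the minimum that defines the treewidth is attained.
\<close>

lemma tree_decomposition_of_treewidth:
  assumes H: "finite (pverts H)" "parcs H \<subseteq> pverts H \<times> pverts H"
  obtains T :: "nat pair_pre_digraph" and B
  where "tree_decomposition H T B" "decomposition_width T B = treewidth H"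
proof -
  let ?T = "\<lparr>pverts = {0::nat}, parcs = {}\<rparr>"
  let ?D = "\<lambda>k. \<exists>(T :: nat pair_pre_digraph) B.
     tree_decomposition H T B \<and> decomposition_width T B = k"
  have one: "Digraph_Component.connected G" if "verts G = {0}" for G :: "(nat, nat \<times> nat) pre_digraph"
    using that by (auto simp: Digraph_Component.connected_def strongly_connected_def reachable_def)
  have "pair_graph ?T"
    by unfold_locales (auto simp: symmetric_def sym_def)
  moreover have "\<not> pre_digraph.cycle (with_proj ?T) p" for p
    by (auto simp: pre_digraph.cycle_def pre_digraph.awalk_def)
  ultimately have "tree_decomposition H ?T (\<lambda>_. pverts H)"
    using H unfolding tree_decomposition_def tree_graph_def
    by (auto intro!: one)
  then have "?D (decomposition_width ?T (\<lambda>_. pverts H))" by blast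
  then have "?D (treewidth H)" unfolding treewidth_def by (rule LeastI)
  then show thesis using that by blast
qed

lemma connected_induced_iff:
  assumes "sym (parcs T)"
  shows "Digraph_Component.connected (with_proj T \<restriction> S) \<longleftrightarrow> connected_in (parcs T) S"
proof -
  have "parcs (mk_symmetric (with_proj T \<restriction> S)) = parcs T \<inter> S \<times> S"
    using assms by (auto simp: parcs_mk_symmetric dest: symD)
  moreover have "(u, v) \<in> rtrancl_on S (parcs T \<inter> S \<times> S) \<longleftrightarrow> (u, v) \<in> rtrancl_on S (parcs T)" for u v
  proof
    assume "(u, v) \<in> rtrancl_on S (parcs T)"
    then show "(u, v) \<in> rtrancl_on S (parcs T \<inter> S \<times> S)"
      by (induction rule: rtrancl_on_induct) (auto intro: rtrancl_on_into_rtrancl_on)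
  next
    assume "(u, v) \<in> rtrancl_on S (parcs T \<inter> S \<times> S)"
    then show "(u, v) \<in> rtrancl_on S (parcs T)"
      by (rule rtrancl_on_mono[rotated 2]) auto
  qed
  ultimately show ?thesis
    by (auto simp: Digraph_Component.connected_def strongly_connected_def reachable_def connected_in_def)
qed

lemma embeds_as_subgraphE:
  assumes "embeds_as_subgraph G H"
  obtains f where "inj_on f (pverts G)" "f ` pverts G \<subseteq> pverts H"
    "\<And>u v. (u, v) \<in> parcs G \<Longrightarrow> (f u, f v) \<in> parcs H"
proof -
  obtain S h where S: "subgraph (with_proj S) (with_proj H)"
    and h: "pre_digraph.digraph_isomorphism (with_proj G) h" "with_proj S = app_iso h (with_proj G)"
    using assms unfolding embeds_as_subgraph_def digraph_iso_def by blast
  have S': "pverts S = iso_verts h ` pverts G" "parcs S = iso_arcs h ` parcs G"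
    "iso_tail h = fst" "iso_head h = snd"
    using arg_cong[OF h(2), of verts] arg_cong[OF h(2), of arcs]
      arg_cong[OF h(2), of tail] arg_cong[OF h(2), of head] by auto
  have "(iso_verts h u, iso_verts h v) \<in> parcs H" if "(u, v) \<in> parcs G" for u v
  proof -
    have "fst (iso_arcs h (u, v)) = iso_verts h u" "snd (iso_arcs h (u, v)) = iso_verts h v"
      using h(1) that S'(3,4) unfolding pre_digraph.digraph_isomorphism_def by auto
    then have "iso_arcs h (u, v) = (iso_verts h u, iso_verts h v)" by (simp add: prod_eq_iff)
    then have "(iso_verts h u, iso_verts h v) \<in> parcs S" using S'(2) that by (metis imageI)
    then show ?thesis using S unfolding subgraph_def by auto
  qed
  then show thesis
    using that[of "iso_verts h"] h(1) S S'
    unfolding pre_digraph.digraph_isomorphism_def subgraph_def by auto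
qed

text \<open>
  The obstruction. The connected sets \<open>R k\<close> are the branch sets of a complete minor, and \<open>a\<close> is
  adjacent to all their vertices, which therefore live in the at most three layers of
  \<open>H \<boxtimes> P\<close> around the layer of \<open>a\<close>. The branch sets trace out pairwise intersecting subtrees of a
  tree decomposition of \<open>H\<close>, hence by the Helly property some bag meets the projections of all of
  them. As the branch sets are disjoint, they need distinct places in that bag times three layers,
  and there are only \<open>3 * (c + 1)\<close> of those.
\<close>

lemma dominated_clique_minor_in_product:
  fixes H :: "'b pair_pre_digraph" and R :: "nat \<Rightarrow> 'a set"
  assumes H: "pair_graph H" and tw: "treewidth H \<le> c" and P: "path_graph P"
    and emb: "embeds_as_subgraph G (H \<boxtimes> P)"
    and sub: "\<And>k. k < m \<Longrightarrow> R k \<subseteq> pverts G"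
    and conn: "\<And>k. k < m \<Longrightarrow> connected_in (parcs G) (R k)"
    and disj: "\<And>k l. k < l \<Longrightarrow> l < m \<Longrightarrow> R k \<inter> R l = {}"
    and touch: "\<And>k l. k < l \<Longrightarrow> l < m \<Longrightarrow> \<exists>u\<in>R k. \<exists>v\<in>R l. (u, v) \<in> parcs G"
    and dom: "\<And>k v. k < m \<Longrightarrow> v \<in> R k \<Longrightarrow> (a, v) \<in> parcs G"
  shows "m \<le> 3 * (c + 1)"
proof (cases "m = 0")
  case False
  interpret H: pair_graph H by fact
  have arcs_H: "parcs H \<subseteq> pverts H \<times> pverts H"
    using H.in_arcsD1 H.in_arcsD2 by auto
  obtain T :: "nat pair_pre_digraph" and B
    where dec: "tree_decomposition H T B" and width: "decomposition_width T B = treewidth H"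
    using tree_decomposition_of_treewidth[OF H.pair_finite_verts arcs_H] by blast
  then have T: "pair_graph T" "no_long_cycle T"
    by (auto simp: tree_decomposition_def tree_graph_def no_long_cycle_def)
  interpret T: pair_graph T by fact
  have bags: "(\<Union>t \<in> pverts T. B t) = pverts H"
    using dec by (simp add: tree_decomposition_def)
  have bag_edge: "\<exists>t \<in> pverts T. u \<in> B t \<and> v \<in> B t" if "(u, v) \<in> parcs H" for u v
    using dec that by (auto simp: tree_decomposition_def)
  have sym: "sym (parcs T)" using T.pair_sym_arcs by (simp add: symmetric_def)
  obtain f where inj: "inj_on f (pverts G)" and f: "f ` pverts G \<subseteq> pverts (H \<boxtimes> P)"
    and edge: "\<And>u v. (u, v) \<in> parcs G \<Longrightarrow> (f u, f v) \<in> parcs (H \<boxtimes> P)"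
    using embeds_as_subgraphE[OF emb] by metis
  define F where "F v = {t \<in> pverts T. fst (f v) \<in> B t}" for v
  have fst_f: "fst (f v) \<in> pverts H" if "v \<in> pverts G" for v
    using f that by (auto simp: strong_product_def)
  have F_conn: "connected_in (parcs T) (F v)" if "v \<in> pverts G" for v
    using dec fst_f[OF that] connected_induced_iff[OF sym]
    by (simp add: tree_decomposition_def F_def)
  have F_meet: "F u \<inter> F v \<noteq> {}" if "(u, v) \<in> parcs G" for u v
  proof -
    have "fst (f u) \<in> pverts H" "fst (f u) = fst (f v) \<or> (fst (f u), fst (f v)) \<in> parcs H"
      using edge[OF that] by (auto simp: strong_product_def)
    then show ?thesis
      using bags bag_edge by (fastforce simp: F_def)
  qed
  define U where "U k = (\<Union>v\<in>R k. F v)" for k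
  have U_conn: "connected_in (parcs T) (U k)" if k: "k < m" for k
    unfolding U_def
  proof (rule connected_in_UN[OF conn[OF k]])
    show "connected_in (parcs T) (F v)" if "v \<in> R k" for v
      using F_conn sub[OF k] that by auto
  qed (rule F_meet)
  have U_meet: "U k \<inter> U l \<noteq> {}" if kl: "k < m" "l < m" for k l
  proof -
    have lt: "U k \<inter> U l \<noteq> {}" if "k < l" "l < m" for k l
      using touch[OF that] F_meet unfolding U_def by blast
    have "U k \<noteq> {}"
      using U_conn[OF kl(1)] by (simp add: connected_in_def)
    then show ?thesis using lt[of k l] lt[of l k] kl
      by (cases k l rule: linorder_cases) auto
  qed
  have "\<Inter>(U ` {..<m}) \<noteq> {}"
  proof (rule subtrees_helly[OF T T.pair_finite_verts])
    show "U ` {..<m} \<noteq> {}" using False by auto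
    show "S \<subseteq> pverts T" if "S \<in> U ` {..<m}" for S
      using that by (auto simp: U_def F_def)
    show "connected_in (parcs T) S" if "S \<in> U ` {..<m}" for S
      using that U_conn by auto
    show "S \<inter> S' \<noteq> {}" if "S \<in> U ` {..<m}" "S' \<in> U ` {..<m}" for S S'
      using that U_meet by blast
  qed
  then obtain t where t: "\<And>k. k < m \<Longrightarrow> t \<in> U k" by auto
  then have "t \<in> pverts T" using False unfolding U_def F_def by blast
  have "\<forall>k. \<exists>v. k < m \<longrightarrow> v \<in> R k \<and> fst (f v) \<in> B t"
    using t unfolding U_def F_def by blast
  then obtain r where r: "\<And>k. k < m \<Longrightarrow> r k \<in> R k \<and> fst (f (r k)) \<in> B t" by metis
  obtain N where N: "finite N" "card N \<le> 3" "snd (f a) \<in> N"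
    "\<And>q. (snd (f a), q) \<in> parcs P \<Longrightarrow> q \<in> N"
    using path_closed_neighbourhood[OF P, of "snd (f a)"] by blast
  have "finite (B t)"
    using bags \<open>t \<in> pverts T\<close> by (intro finite_subset[OF _ H.pair_finite_verts]) auto
  have "inj_on (\<lambda>k. f (r k)) {..<m}"
  proof (rule linorder_inj_onI)
    fix k l assume "k < l" "k \<in> {..<m}" "l \<in> {..<m}"
    then have "r k \<noteq> r l" "r k \<in> pverts G" "r l \<in> pverts G"
      using disj[of k l] r[of k] r[of l] sub[of k] sub[of l] by auto
    then show "f (r k) \<noteq> f (r l)" using inj by (auto dest: inj_onD)
  qed auto
  moreover have "(\<lambda>k. f (r k)) ` {..<m} \<subseteq> B t \<times> N"
  proof (rule image_subsetI)
    fix k assume "k \<in> {..<m}"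
    then have "(f a, f (r k)) \<in> parcs (H \<boxtimes> P)" "fst (f (r k)) \<in> B t"
      using r dom edge by auto
    then show "f (r k) \<in> B t \<times> N"
      using N(3,4) by (auto simp: strong_product_def mem_Times_iff)
  qed
  moreover have bag_size: "card (B t) \<le> c + 1"
  proof -
    have "card (B t) \<le> Max ((\<lambda>t. card (B t)) ` pverts T)"
      using \<open>t \<in> pverts T\<close> T.pair_finite_verts by (intro Max_ge) auto
    then show ?thesis using width tw unfolding decomposition_width_def by linarith
  qed
  ultimately have "m \<le> card (B t \<times> N)"
    using card_inj_on_le[of "\<lambda>k. f (r k)" "{..<m}" "B t \<times> N"] N(1) \<open>finite (B t)\<close> by simp
  also have "\<dots> = card N * card (B t)" by (simp add: card_cartesian_product)
  also have "\<dots> \<le> 3 * (c + 1)" using N(2) bag_size by (rule mult_le_mono)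
  finally show ?thesis .
qed simp

section \<open>Hyperbolic disk graphs\<close>

lemma hyperbolic_dist_commute: "hyperbolic_dist z w = hyperbolic_dist w z"
  by (simp add: hyperbolic_dist_def norm_minus_commute mult.commute mult.left_commute)

text \<open>
  Choosing the radius as an \<open>arcosh\<close> turns adjacency into a quadratic inequality between coordinates.
\<close>

lemma hyperbolic_dist_le_arcosh_iff:
  assumes "z \<in> hyperbolic_plane" "w \<in> hyperbolic_plane" "0 \<le> s"
  shows "hyperbolic_dist z w \<le> arcosh (1 + s) \<longleftrightarrow> (cmod (z - w))\<^sup>2 \<le> 2 * s * Im z * Im w"
proof -
  define d where "d = (cmod (z - w))\<^sup>2 / (2 * Im z * Im w)"
  have pos: "0 < 2 * Im z * Im w" using assms by (simp add: hyperbolic_plane_def)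
  then have "0 \<le> d" by (simp add: d_def)
  then have "arcosh (1 + d) \<le> arcosh (1 + s) \<longleftrightarrow> d \<le> s"
    using arcosh_less_iff_real[of "1 + s" "1 + d"] assms(3) by (simp flip: not_less)
  also have "\<dots> \<longleftrightarrow> (cmod (z - w))\<^sup>2 \<le> s * (2 * Im z * Im w)"
    unfolding d_def by (rule pos_divide_le_eq[OF pos])
  finally show ?thesis by (simp add: hyperbolic_dist_def d_def ac_simps)
qed

definition disk_graph :: "'a set \<Rightarrow> ('a \<Rightarrow> complex) \<Rightarrow> real \<Rightarrow> 'a pair_pre_digraph" where
  "disk_graph V c r = \<lparr>pverts = V,
     parcs = {(u, v). u \<in> V \<and> v \<in> V \<and> u \<noteq> v \<and> hyperbolic_dist (c u) (c v) \<le> 2 * r}\<rparr>"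

lemma disk_graph_simps [simp]:
  "pverts (disk_graph V c r) = V"
  "(u, v) \<in> parcs (disk_graph V c r) \<longleftrightarrow>
     u \<in> V \<and> v \<in> V \<and> u \<noteq> v \<and> hyperbolic_dist (c u) (c v) \<le> 2 * r"
  by (auto simp: disk_graph_def)

lemma pair_graph_disk_graph:
  assumes "finite V"
  shows "pair_graph (disk_graph V c r)"
proof -
  have "finite (parcs (disk_graph V c r))"
    by (rule finite_subset[of _ "V \<times> V"]) (use assms in auto)
  then show ?thesis
    using assms
    by unfold_locales
      (auto simp: disk_graph_def symmetric_def hyperbolic_dist_commute intro!: symI)
qed

lemma hudg_disk_graph:
  assumes "finite V" "\<And>v. v \<in> V \<Longrightarrow> c v \<in> hyperbolic_plane" "0 < r"
  shows "hudg (disk_graph V c r)"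
  unfolding hudg_def hudg_with_radius_def
  using assms pair_graph_disk_graph[OF assms(1)]
  by (intro exI[of _ r] conjI exI[of _ c]) auto

lemma clique_number_leI:
  assumes bound: "\<And>K. K \<subseteq> pverts G \<Longrightarrow> (\<And>u v. u \<in> K \<Longrightarrow> v \<in> K \<Longrightarrow> u \<noteq> v \<Longrightarrow> (u, v) \<in> parcs G) \<Longrightarrow> card K \<le> b"
    and wf: "wf_digraph (with_proj G)"
  shows "clique_number G \<le> b"
proof -
  let ?C = "{n. \<exists>K :: 'a pair_pre_digraph. subgraph (with_proj K) (with_proj G) \<and>
                complete_digraph n (with_proj K)}"
  have le: "n \<le> b" if n: "n \<in> ?C" for n
  proof -
    obtain K :: "'a pair_pre_digraph" where sub: "subgraph (with_proj K) (with_proj G)"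
      and comp: "complete_digraph n (with_proj K)"
      using n by blast
    have "(u, v) \<in> parcs G" if "u \<in> pverts K" "v \<in> pverts K" "u \<noteq> v" for u v
      using comp sub that unfolding complete_digraph_pair_def subgraph_def by auto
    then show ?thesis
      using bound[of "pverts K"] comp sub unfolding complete_digraph_pair_def subgraph_def by auto
  qed
  have "complete_digraph 0 (with_proj \<lparr>pverts = {}, parcs = {} :: 'a rel\<rparr>)"
    by (simp add: complete_digraph_pair_def)
  moreover have "subgraph (with_proj \<lparr>pverts = {}, parcs = {} :: 'a rel\<rparr>) (with_proj G)"
    using wf by (simp add: subgraph_def wf_digraph_def compatible_def)
  ultimately have "0 \<in> ?C" by blast
  moreover have "finite ?C"
    using le by (meson finite_nat_set_iff_bounded_le)
  ultimately show ?thesis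
    unfolding clique_number_def using le by (subst Max_le_iff) auto
qed

section \<open>Staggered grids on an interval\<close>

text \<open>
  Row \<open>k\<close> of the construction divides the unit interval into \<open>grid_size k\<close> equal cells. The argument
  uses two properties of these numbers: each is an even multiple of the preceding ones, and each is
  at least the cube of every preceding one.
\<close>

definition grid_size :: "nat \<Rightarrow> nat" where
  "grid_size k = 4 ^ 3 ^ k"

lemma grid_size_Suc: "grid_size (Suc k) = grid_size k ^ 3"
  by (simp add: grid_size_def power_mult[symmetric] mult.commute)

lemma grid_size_mono: "k \<le> l \<Longrightarrow> grid_size k \<le> grid_size l"
  by (simp add: grid_size_def power_increasing)

lemma grid_size_ge_4: "4 \<le> grid_size k"
  using grid_size_mono[of 0 k] by (simp add: grid_size_def)

lemma grid_size_cube_le: "k < l \<Longrightarrow> grid_size k ^ 3 \<le> grid_size l"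
  using grid_size_mono[of "Suc k" l] by (simp add: grid_size_Suc)

lemma grid_size_even_multiple:
  assumes "k < l"
  obtains q where "1 \<le> q" "grid_size l = 2 * q * grid_size k"
proof -
  have "(3::nat) ^ k < 3 ^ l" using assms by simp
  then obtain d where "(3::nat) ^ l = 3 ^ k + Suc d" using less_imp_Suc_add by fastforce
  then have "grid_size l = 2 * (2 * 4 ^ d) * grid_size k"
    by (simp add: grid_size_def power_add)
  then show thesis by (intro that[of "2 * 4 ^ d"]) auto
qed

text \<open>
  The midpoint of cell \<open>j\<close>. Midpoints of a coarse row are cell boundaries of every finer row, so
  points of different rows are never exactly above each other; see \<open>abscissa_gap\<close>.
\<close>

definition abscissa :: "nat \<Rightarrow> nat \<Rightarrow> real" where
  "abscissa k j = (2 * real j + 1) / (2 * real (grid_size k))"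

lemma abscissa_bounds: "j < grid_size k \<Longrightarrow> 0 \<le> abscissa k j \<and> abscissa k j \<le> 1"
  using grid_size_ge_4[of k] by (simp add: abscissa_def field_simps)

lemma abscissa_Suc: "abscissa k (Suc j) - abscissa k j = 1 / real (grid_size k)"
  using grid_size_ge_4[of k] by (simp add: abscissa_def field_simps)

text \<open>
  The first point of row \<open>k\<close> is a cell boundary of row \<open>l\<close>; the cell to its right has its midpoint
  half a cell away.
\<close>

lemma abscissa_below:
  assumes "k < l"
  obtains j where "j < grid_size l" "abscissa l j - abscissa k 0 = 1 / (2 * real (grid_size l))"
proof -
  obtain q where q: "1 \<le> q" "grid_size l = 2 * q * grid_size k"
    using grid_size_even_multiple[OF assms] .
  show thesis
  proof (rule that[of q])
    show "q < grid_size l" using q grid_size_ge_4[of k] by simp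
    show "abscissa l q - abscissa k 0 = 1 / (2 * real (grid_size l))"
      using q grid_size_ge_4[of k] by (simp add: abscissa_def field_simps)
  qed
qed

text \<open>
  Measured in half cells of row \<open>l\<close>, points of row \<open>l\<close> have odd and points of row \<open>k\<close> have even
  coordinates, so they differ by at least one half cell.
\<close>

lemma abscissa_gap:
  assumes "k < l"
  shows "1 / (4 * (real (grid_size l))\<^sup>2) \<le> (abscissa k i - abscissa l j)\<^sup>2"
proof -
  obtain q where q: "1 \<le> q" "grid_size l = 2 * q * grid_size k"
    using grid_size_even_multiple[OF assms] .
  define d where "d = (2 * int i + 1) * (2 * int q) - (2 * int j + 1)"
  have "odd d" by (simp add: d_def)
  then have "d \<noteq> 0" by auto
  then have "0 < d\<^sup>2" by simp
  then have "1 \<le> d\<^sup>2" by linarith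
  then have "1 \<le> (real_of_int d)\<^sup>2" by (simp flip: of_int_power)
  moreover have "abscissa k i - abscissa l j = real_of_int d / (2 * real (grid_size l))"
    using q grid_size_ge_4[of k] by (simp add: abscissa_def d_def field_simps)
  moreover have "0 < real (grid_size l)" using grid_size_ge_4[of l] by simp
  ultimately show ?thesis by (simp add: power_divide power_mult_distrib divide_right_mono)
qed

section \<open>Rows of points below an apex\<close>

text \<open>
  Vertex 0 is reserved for the apex.
\<close>

definition site :: "nat \<Rightarrow> nat \<Rightarrow> nat" where
  "site k j = Suc (prod_encode (k, j))"

lemma site_eq_iff [simp]: "site k i = site l j \<longleftrightarrow> k = l \<and> i = j"
  by (auto simp: site_def)

lemma site_neq_0 [simp]: "site k j \<noteq> 0" "0 \<noteq> site k j"
  by (auto simp: site_def)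

text \<open>
  With \<open>S = grid_size m\<close>, a point at abscissa \<open>x\<close> of row \<open>k\<close> is placed at \<open>(S * x, 1 / grid_size k)\<close>,
  and the apex at height \<open>S\<close>. Disks are given the radius for which \<open>z\<close> and \<open>w\<close> are adjacent iff
  \<open>(cmod (z - w))\<^sup>2 \<le> 2 * S\<^sup>2 * Im z * Im w\<close>. Horizontal distances are stretched by \<open>S\<close> while heights in
  the rows are at most 1, so within the rows vertical distances hardly matter, and two points are
  adjacent roughly iff their abscissae differ by at most the geometric mean of their heights.
\<close>

definition centre :: "nat \<Rightarrow> nat \<Rightarrow> complex" where
  "centre m v = (case v of
       0 \<Rightarrow> Complex 0 (grid_size m)
     | Suc w \<Rightarrow> (case prod_decode w of (k, j) \<Rightarrow>
         Complex (grid_size m * abscissa k j) (1 / grid_size k)))"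

lemma centre_0: "centre m 0 = Complex 0 (grid_size m)"
  by (simp add: centre_def)

lemma centre_site: "centre m (site k j) = Complex (grid_size m * abscissa k j) (1 / grid_size k)"
  by (simp add: centre_def site_def)

definition row :: "nat \<Rightarrow> nat set" where
  "row k = site k ` {..<grid_size k}"

definition apex_rows :: "nat \<Rightarrow> nat pair_pre_digraph" where
  "apex_rows m = disk_graph (insert 0 (\<Union>k<m. row k)) (centre m) (arcosh (1 + (grid_size m)\<^sup>2) / 2)"

lemma finite_apex_rows: "finite (pverts (apex_rows m))"
  by (simp add: apex_rows_def row_def)

lemma centre_in_plane: "centre m v \<in> hyperbolic_plane"
  using grid_size_ge_4
  by (auto simp: centre_def hyperbolic_plane_def less_le_trans[OF _ grid_size_ge_4] split: nat.split prod.split)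

lemma hudg_apex_rows: "hudg (apex_rows m)"
proof -
  have "0 < (real (grid_size m))\<^sup>2" using grid_size_ge_4[of m] by simp
  then have "0 < arcosh (1 + (real (grid_size m))\<^sup>2)"
    by (subst arcosh_real_gt_1_iff) auto
  then show ?thesis
    unfolding apex_rows_def using centre_in_plane
    by (intro hudg_disk_graph) (auto simp: row_def)
qed

lemma apex_rows_arc_iff:
  "(u, v) \<in> parcs (apex_rows m) \<longleftrightarrow>
     u \<in> pverts (apex_rows m) \<and> v \<in> pverts (apex_rows m) \<and> u \<noteq> v \<and>
     (cmod (centre m u - centre m v))\<^sup>2 \<le> 2 * (grid_size m)\<^sup>2 * Im (centre m u) * Im (centre m v)"
proof -
  have "0 \<le> (real (grid_size m))\<^sup>2" by simp
  from hyperbolic_dist_le_arcosh_iff[OF centre_in_plane centre_in_plane this, of m u m v]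
  show ?thesis by (auto simp: apex_rows_def)
qed

text \<open>
  The factor 2 in the adjacency condition leaves as much room for the vertical distance as for the
  horizontal one. The vertical distance is less than 1, and \<open>S\<close> times a height is at least 1.
\<close>

lemma site_arcI:
  assumes "k < m" "l < m" "i < grid_size k" "j < grid_size l" "(k, i) \<noteq> (l, j)"
    and close: "(abscissa k i - abscissa l j)\<^sup>2 \<le> 1 / (real (grid_size k) * real (grid_size l))"
  shows "(site k i, site l j) \<in> parcs (apex_rows m)"
proof -
  define S a b where "S = real (grid_size m)" and "a = 1 / real (grid_size k)" and "b = 1 / real (grid_size l)"
  have Sab: "0 < a" "a \<le> 1" "0 < b" "b \<le> 1" "1 \<le> S * a" "1 \<le> S * b"
    using grid_size_ge_4[of k] grid_size_ge_4[of l] grid_size_mono[of k m] grid_size_mono[of l m] assms(1,2)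
    by (auto simp: S_def a_def b_def)
  have "(a - b)\<^sup>2 \<le> 1" using Sab by (intro abs_square_le_1[THEN iffD2]) auto
  also have "1 \<le> (S * a) * (S * b)" using mult_mono[OF Sab(5,6)] Sab by auto
  finally have "(a - b)\<^sup>2 \<le> S\<^sup>2 * (a * b)" by (simp add: power2_eq_square ac_simps)
  moreover have "S\<^sup>2 * (abscissa k i - abscissa l j)\<^sup>2 \<le> S\<^sup>2 * (a * b)"
    using close by (intro mult_left_mono) (auto simp: a_def b_def)
  ultimately have "(S * abscissa k i - S * abscissa l j)\<^sup>2 + (a - b)\<^sup>2 \<le> 2 * S\<^sup>2 * a * b"
    by (simp add: power_mult_distrib flip: right_diff_distrib)
  then show ?thesis
    using assms unfolding apex_rows_arc_iff
    by (auto simp: centre_site cmod_power2 apex_rows_def row_def S_def a_def b_def)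
qed

lemma site_arcD:
  assumes "(site k i, site l j) \<in> parcs (apex_rows m)"
  shows "(abscissa k i - abscissa l j)\<^sup>2 \<le> 2 / (real (grid_size k) * real (grid_size l))"
proof -
  define S where "S = real (grid_size m)"
  have S: "0 < S" using grid_size_ge_4[of m] by (simp add: S_def)
  have "(S * (abscissa k i - abscissa l j))\<^sup>2 \<le> 2 * S\<^sup>2 * (1 / grid_size k) * (1 / grid_size l)"
    using assms unfolding apex_rows_arc_iff
    by (auto simp: centre_site cmod_power2 S_def right_diff_distrib intro: order_trans[rotated])
  then have "S\<^sup>2 * (abscissa k i - abscissa l j)\<^sup>2
      \<le> S\<^sup>2 * (2 / (real (grid_size k) * real (grid_size l)))"
    by (simp add: power_mult_distrib ac_simps)
  then show ?thesis by (rule mult_left_le_imp_le) (use S in simp)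
qed

text \<open>
  Both coordinates of the displacement from the apex are at most \<open>S\<close>, and the height of a point
  in the rows is at least \<open>1 / S\<close>.
\<close>

lemma apex_arc:
  assumes "k < m" "v \<in> row k"
  shows "(0, v) \<in> parcs (apex_rows m)"
proof -
  obtain j where v: "v = site k j" "j < grid_size k" using assms(2) by (auto simp: row_def)
  define S x y where "S = real (grid_size m)" and "x = abscissa k j" and "y = 1 / real (grid_size k)"
  have b: "0 < S" "0 \<le> x" "x \<le> 1" "0 < y" "y \<le> 1" "1 \<le> S" "1 \<le> S * y"
    using grid_size_ge_4[of k] grid_size_ge_4[of m] grid_size_mono[of k m] assms(1) abscissa_bounds[OF v(2)]
    by (auto simp: S_def x_def y_def)
  have "(S * x)\<^sup>2 + (S - y)\<^sup>2 \<le> S\<^sup>2 + S\<^sup>2"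
    using b by (intro add_mono power_mono) (auto simp: mult_left_le)
  also have "\<dots> \<le> 2 * S\<^sup>2 * (S * y)" using mult_left_mono[OF b(7), of "S\<^sup>2"] by simp
  finally have "(S * x)\<^sup>2 + (S - y)\<^sup>2 \<le> 2 * S\<^sup>2 * S * y" by (simp add: ac_simps)
  then show ?thesis
    using assms v unfolding apex_rows_arc_iff
    by (auto simp: centre_site centre_0 cmod_power2 apex_rows_def S_def x_def y_def)
qed

lemma row_consecutive_arc:
  assumes "k < m" "Suc j < grid_size k"
  shows "(site k j, site k (Suc j)) \<in> parcs (apex_rows m)"
proof (rule site_arcI)
  have "(abscissa k j - abscissa k (Suc j))\<^sup>2 = (1 / real (grid_size k))\<^sup>2"
    by (metis abscissa_Suc power2_commute)
  then show "(abscissa k j - abscissa k (Suc j))\<^sup>2 \<le> 1 / (real (grid_size k) * real (grid_size k))"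
    by (simp add: power2_eq_square)
qed (use assms in auto)

lemma rows_touch:
  assumes "k < l" "l < m"
  shows "\<exists>u\<in>row k. \<exists>v\<in>row l. (u, v) \<in> parcs (apex_rows m)"
proof -
  obtain j where j: "j < grid_size l" "abscissa l j - abscissa k 0 = 1 / (2 * real (grid_size l))"
    using abscissa_below[OF assms(1)] .
  have "(abscissa k 0 - abscissa l j)\<^sup>2 = (1 / (2 * real (grid_size l)))\<^sup>2"
    using j(2) by (metis power2_commute)
  also have "\<dots> \<le> 1 / (real (grid_size l) * real (grid_size l))"
    by (simp add: power2_eq_square divide_simps)
  also have "\<dots> \<le> 1 / (real (grid_size k) * real (grid_size l))"
    using grid_size_mono[of k l] grid_size_ge_4[of k] assms(1)
    by (intro divide_left_mono mult_right_mono mult_pos_pos) auto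
  finally have "(site k 0, site l j) \<in> parcs (apex_rows m)"
    using assms j(1) grid_size_ge_4[of k] by (intro site_arcI) auto
  then show ?thesis using j(1) grid_size_ge_4[of k] by (auto simp: row_def)
qed

text \<open>
  This is what keeps the cliques small. A point of a low row \<open>r\<close> only reaches a short way sideways
  to points of higher rows, so two points of rows \<open>k\<close> and \<open>l\<close> with a common neighbour in row \<open>r\<close> are almost
  above each other: the square of their distance is at most \<open>2 / grid_size r\<close>. The staggering of the
  grids forces at least \<open>1 / (4 * (grid_size l)\<^sup>2)\<close>, which is larger because of the cubic growth.
\<close>

lemma no_common_neighbour_in_lower_row:
  assumes kl: "k < l" and lr: "l < r"
    and arcs: "(site k i, site r n) \<in> parcs (apex_rows m)" "(site l j, site r n) \<in> parcs (apex_rows m)"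
  shows False
proof -
  define x y z where "x = abscissa k i" and "y = abscissa l j" and "z = abscissa r n"
  define K L R where "K = real (grid_size k)" and "L = real (grid_size l)" and "R = real (grid_size r)"
  \<comment> \<open>Row \<open>l\<close> is not the topmost one, so its size is at least \<open>grid_size 1 = 64\<close>.\<close>
  have "64 \<le> grid_size l"
    using grid_size_mono[of 1 l] kl by (simp add: grid_size_def)
  then have L: "64 \<le> L" by (simp add: L_def)
  have K: "4 \<le> K" using grid_size_ge_4[of k] by (simp add: K_def)
  have "real (grid_size l ^ 3) \<le> R"
    unfolding R_def using grid_size_cube_le[OF lr] of_nat_le_iff by blast
  then have R: "L ^ 3 \<le> R" by (simp add: L_def)
  have "0 < L ^ 3" using L by simp
  with R have R0: "0 < R" by linarith
  have "1 / (4 * L\<^sup>2) \<le> (x - y)\<^sup>2"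
    using abscissa_gap[OF kl] by (simp add: x_def y_def L_def)
  also have "\<dots> \<le> 2 * (x - z)\<^sup>2 + 2 * (y - z)\<^sup>2"
  proof -
    have "0 \<le> ((x - z) + (y - z))\<^sup>2" by simp
    then show ?thesis by (simp add: power2_eq_square algebra_simps)
  qed
  also have "\<dots> \<le> 2 * (2 / (K * R)) + 2 * (2 / (L * R))"
    using site_arcD[OF arcs(1)] site_arcD[OF arcs(2)]
    by (simp add: x_def y_def z_def K_def L_def R_def)
  also have "\<dots> \<le> 2 * (2 / (4 * R)) + 2 * (2 / (4 * R))"
    using K L R0 by (intro add_mono mult_left_mono divide_left_mono mult_right_mono mult_pos_pos) auto
  also have "\<dots> = 2 / R" by simp
  also have "\<dots> \<le> 2 / L ^ 3"
    by (intro divide_left_mono mult_pos_pos R R0 \<open>0 < L ^ 3\<close>) simp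
  finally have "L \<le> 8" using L by (simp add: field_simps power2_eq_square power3_eq_cube)
  then show False using L by simp
qed

text \<open>
  Points of one row that are two cells apart have distance \<open>2 / grid_size k\<close>, which exceeds the limit
  \<open>sqrt 2 / grid_size k\<close> from \<open>site_arcD\<close>.
\<close>

lemma row_arc_indices:
  assumes "(site k i, site k j) \<in> parcs (apex_rows m)"
  shows "i \<le> Suc j"
proof (rule ccontr)
  assume far: "\<not> i \<le> Suc j"
  define S where "S = real (grid_size k)"
  have S: "0 < S" using grid_size_ge_4[of k] by (simp add: S_def)
  have "abscissa k i - abscissa k j = (real i - real j) / S"
    using S by (simp add: abscissa_def S_def field_simps)
  then have "(real i - real j)\<^sup>2 / (S * S) \<le> 2 / (S * S)"
    using site_arcD[OF assms] by (simp add: S_def power_divide power2_eq_square)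
  then have "(real i - real j)\<^sup>2 \<le> 2" using S by (simp add: divide_le_cancel)
  moreover have "2\<^sup>2 \<le> (real i - real j)\<^sup>2" using far by (intro power_mono) auto
  ultimately show False by simp
qed

lemma three_increasing:
  fixes L :: "nat set"
  assumes "3 \<le> card L"
  obtains a b c where "a \<in> L" "b \<in> L" "c \<in> L" "a < b" "b < c"
proof -
  have fin: "finite L" using assms card.infinite by fastforce
  then have ne: "L \<noteq> {}" using assms by auto
  have "card {Min L, Max L} < card L"
    using assms by (cases "Min L = Max L") auto
  then have "\<not> L \<subseteq> {Min L, Max L}"
    using card_mono[of "{Min L, Max L}" L] by auto
  then obtain b where b: "b \<in> L" "b \<noteq> Min L" "b \<noteq> Max L" by blast
  show thesis
    using that[of "Min L" b "Max L"] b fin ne Min_le[OF fin b(1)] Max_ge[OF fin b(1)] by auto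
qed

text \<open>
  Besides the apex, a clique has at most two points in each of at most two rows.
\<close>

lemma clique_number_apex_rows: "clique_number (apex_rows m) \<le> 5"
proof (rule clique_number_leI)
  show "wf_digraph (with_proj (apex_rows m))"
    by (auto simp: wf_digraph_def apex_rows_def disk_graph_def)
next
  fix K assume sub: "K \<subseteq> pverts (apex_rows m)"
    and clique: "\<And>u v. u \<in> K \<Longrightarrow> v \<in> K \<Longrightarrow> u \<noteq> v \<Longrightarrow> (u, v) \<in> parcs (apex_rows m)"
  define L where "L = {k. K \<inter> row k \<noteq> {}}"
  have "card L \<le> 2"
  proof (rule ccontr)
    assume "\<not> card L \<le> 2"
    then have "3 \<le> card L" by simp
    then obtain k l r where klr: "k \<in> L" "l \<in> L" "r \<in> L" "k < l" "l < r"
      using three_increasing by metis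
    obtain i j n where "site k i \<in> K" "site l j \<in> K" "site r n \<in> K"
      using klr(1-3) by (auto simp: L_def row_def)
    then show False
      using no_common_neighbour_in_lower_row[OF klr(4,5), of i n m j] clique klr(4,5) by auto
  qed
  moreover have two: "card (K \<inter> row k) \<le> 2" for k
  proof -
    define J where "J = {j. site k j \<in> K}"
    have close: "i \<le> Suc j" if "i \<in> J" "j \<in> J" for i j
      using row_arc_indices[of k i j m] clique[of "site k i" "site k j"] that
      by (cases "i = j") (auto simp: J_def)
    have "J \<subseteq> {(LEAST j. j \<in> J), Suc (LEAST j. j \<in> J)}"
    proof
      fix i assume i: "i \<in> J"
      show "i \<in> {(LEAST j. j \<in> J), Suc (LEAST j. j \<in> J)}"
        using Least_le[of "\<lambda>j. j \<in> J", OF i] close[OF i LeastI[of "\<lambda>j. j \<in> J", OF i]] by auto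
    qed
    then have "K \<inter> row k \<subseteq> site k ` {(LEAST j. j \<in> J), Suc (LEAST j. j \<in> J)}"
      by (auto simp: row_def J_def)
    then have "card (K \<inter> row k) \<le> card (site k ` {(LEAST j. j \<in> J), Suc (LEAST j. j \<in> J)})"
      by (intro card_mono) auto
    also have "\<dots> \<le> 2" by (rule order_trans[OF card_image_le]) auto
    finally show ?thesis .
  qed
  moreover have "finite L"
  proof (rule finite_subset)
    show "L \<subseteq> {..<m}" using sub by (auto simp: L_def apex_rows_def row_def)
  qed auto
  have "K \<subseteq> insert 0 (\<Union>k\<in>L. K \<inter> row k)"
  proof
    fix v assume v: "v \<in> K"
    show "v \<in> insert 0 (\<Union>k\<in>L. K \<inter> row k)"
    proof (cases "v = 0")
      case False
      then obtain k where "v \<in> row k" using v sub by (auto simp: apex_rows_def)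
      then have "k \<in> L" "v \<in> K \<inter> row k" using v by (auto simp: L_def)
      then show ?thesis by blast
    qed simp
  qed
  moreover have "finite (\<Union>k\<in>L. K \<inter> row k)" using \<open>finite L\<close> by (auto simp: row_def)
  ultimately have "card K \<le> card (insert 0 (\<Union>k\<in>L. K \<inter> row k))"
    by (intro card_mono) auto
  also have "\<dots> \<le> Suc (card (\<Union>k\<in>L. K \<inter> row k))"
    using \<open>finite (\<Union>k\<in>L. K \<inter> row k)\<close> by (simp add: card_insert_if)
  also have "card (\<Union>k\<in>L. K \<inter> row k) \<le> (\<Sum>k\<in>L. card (K \<inter> row k))"
    by (rule card_UN_le[OF \<open>finite L\<close>])
  also have "\<dots> \<le> (\<Sum>k\<in>L. 2)" by (intro sum_mono two)
  also have "\<dots> \<le> 4" using \<open>card L \<le> 2\<close> by simp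
  finally show "card K \<le> 5" by simp
qed

lemma sym_apex_rows: "sym (parcs (apex_rows m))"
proof -
  interpret pair_graph "apex_rows m"
    using finite_apex_rows[of m] unfolding apex_rows_def by (intro pair_graph_disk_graph) simp
  show ?thesis using pair_sym_arcs by (simp add: symmetric_def)
qed

section \<open>Unbounded row-treewidth at bounded clique number\<close>

theorem theorem1:
  shows "\<exists>\<omega>\<^sub>0 :: nat. \<forall>c :: nat. \<exists>G :: nat pair_pre_digraph.
           hudg G \<and> clique_number G \<le> \<omega>\<^sub>0 \<and>
           (\<forall>(H :: nat pair_pre_digraph) (P :: nat pair_pre_digraph).
              pair_graph H \<and> treewidth H \<le> c \<and> path_graph P \<longrightarrow>
              \<not> embeds_as_subgraph G (H \<boxtimes> P))"
proof (intro exI[of _ 5] allI)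
  fix c :: nat
  \<comment> \<open>One branch set more than the product can accommodate.\<close>
  define m where "m = 3 * (c + 1) + 1"
  have no_embedding: "\<not> embeds_as_subgraph (apex_rows m) (H \<boxtimes> P)"
    if HP: "pair_graph H \<and> treewidth H \<le> c \<and> path_graph P"
    for H P :: "nat pair_pre_digraph"
  proof
    assume emb: "embeds_as_subgraph (apex_rows m) (H \<boxtimes> P)"
    have "m \<le> 3 * (c + 1)"
    proof (rule dominated_clique_minor_in_product[OF _ _ _ emb])
      show "pair_graph H" "treewidth H \<le> c" "path_graph P" using HP by auto
      show "row k \<subseteq> pverts (apex_rows m)" if "k < m" for k
        using that by (auto simp: apex_rows_def)
      show "connected_in (parcs (apex_rows m)) (row k)" if "k < m" for k
        unfolding row_def
        using grid_size_ge_4[of k] that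
        by (intro connected_in_consecutive sym_apex_rows row_consecutive_arc) auto
      show "row k \<inter> row l = {}" if "k < l" "l < m" for k l
        using that by (auto simp: row_def)
      show "\<exists>u\<in>row k. \<exists>v\<in>row l. (u, v) \<in> parcs (apex_rows m)" if "k < l" "l < m" for k l
        using rows_touch[OF that] .
      show "(0, v) \<in> parcs (apex_rows m)" if "k < m" "v \<in> row k" for k v
        using apex_arc[OF that] .
    qed
    then show False by (simp add: m_def)
  qed
  show "\<exists>G :: nat pair_pre_digraph. hudg G \<and> clique_number G \<le> 5 \<and>
      (\<forall>(H :: nat pair_pre_digraph) (P :: nat pair_pre_digraph).
         pair_graph H \<and> treewidth H \<le> c \<and> path_graph P \<longrightarrow> \<not> embeds_as_subgraph G (H \<boxtimes> P))"
    using hudg_apex_rows clique_number_apex_rows no_embedding by blast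
qed

end
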